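(* For an infinite real matrix $A=(a_{nk})_{n,k\in\mathbb{N}}$ and $m,n,k\in\mathbb{N}$ put $d_{mk}^{(n)}=\sum_{j=k}^{m}\frac{f_{j+1}^{2}}{f_{k}f_{k+1}}a_{nj}$ if $0\le k\le m$ and $d_{mk}^{(n)}=0$ if $k>m$. Consider the following conditions on $A$: (C1) $\sup_{m\in\mathbb{N}}\sum_{k=0}^{m}|d_{mk}^{(n)}|<\infty$ for each $n\in\mathbb{N}$; (C2) the limit $d_{nk}:=\lim_{m\to\infty}d_{mk}^{(n)}$ exists (and is finite) for each $k,n\in\mathbb{N}$; (C3) $\sup_{n\in\mathbb{N}}\sum_{k=0}^\infty|d_{nk}|<\infty$; (C4) the limit $\alpha_k:=\lim_{n\to\infty}d_{nk}$ exists (and is finite) for each $k\in\mathbb{N}$; (C5) $\sup_{N,K\in\mathcal{F}}\big|\sum_{n\in N}\sum_{k\in K}d_{nk}\big|<\infty$; (C6) the limit $\beta_n:=\lim_{m\to\infty}\sum_{k=0}^{m}d_{mk}^{(n)}$ exists (and is finite) for each $n\in\mathbb{N}$; (C7) the limit $\alpha:=\lim_{n\to\infty}\sum_{k=0}^\infty d_{nk}$ exists (and is finite); where in (C3), (C4), (C5), (C7) $d_{nk}$ is the limit from (C2). Let $A=(a_{nk})$ be an infinite real matrix, let $A^{\Sigma}=(a(n,k))_{n,k}$ with $a(n,k)=\sum_{j=0}^{n}a_{jk}$, and let $A^{\Delta}=(a_{nk}-a_{n-1,k})_{n,k}$ with $a_{-1,k}:=0$. Then: (a) $A\in(c(\widehat{F}),\ell_{\infty})$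 if and only if $A$ satisfies (C1), (C2), (C3) and (C6). (b) $A\in(c(\widehat{F}),bs)$ if and only if $A^{\Sigma}$ satisfies (C1), (C2), (C3) and (C6). (c) $A\in(c(\widehat{F}),c)$ if and only if $A$ satisfies (C1), (C2), (C3), (C4), (C6) and (C7). (d) $A\in(c(\widehat{F}),cs)$ if and only if $A^{\Sigma}$ satisfies (C1), (C2), (C3), (C4), (C6) and (C7). (e) $A\in(c(\widehat{F}),c_{0})$ if and only if $A$ satisfies (C1), (C2), (C3), (C4) with $\alpha_{k}=0$ for all $k\in\mathbb{N}$, (C6), and (C7) with $\alpha=0$. (f) $A\in(c(\widehat{F}),cs_{0})$ if and only if $A^{\Sigma}$ satisfies (C1), (C2), (C3), (C4) with $\alpha_{k}=0$ for all $k\in\mathbb{N}$, (C6), and (C7) with $\alpha=0$. (g) $A\in(c(\widehat{F}),\ell_{1})$ if and only if $A$ satisfies (C1), (C2), (C5) and (C6). (h) $A\in(c(\widehat{F}),bv_{1})$ if and only if $A^{\Delta}$ satisfies (C1), (C2), (C5) and (C6).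
   Context: Let $\mathbb{N}=\{0,1,2,\dots\}$, let $\mathcal{F}$ be the collection of all finite subsets of $\mathbb{N}$, and let $\omega$ be the vector space of all real sequences $x=(x_k)_{k\in\mathbb{N}}$. The Fibonacci numbers are defined by $f_0=f_1=1$ and $f_n=f_{n-1}+f_{n-2}$ for $n\ge 2$. For $x\in\omega$ the $\widehat{F}$-transform $\widehat{F}x=(\widehat{F}_n(x))_{n\in\mathbb{N}}$ is defined by $\widehat{F}_0(x)=x_0$ and $\widehat{F}_n(x)=\frac{f_n}{f_{n+1}}x_n-\frac{f_{n+1}}{f_n}x_{n-1}$ for $n\ge1$. Let $c_0$, $c$, $\ell_\infty$, $\ell_1$ be the spaces of null, convergent, bounded and absolutely summable sequences, and put $c(\widehat{F})=\{x\in\omega:\widehat{F}x\in c\}$. Let $bs$, $cs$, $cs_0$ be the spaces of sequences $x\in\omega$ whose sequence of partial sums $\big(\sum_{k=0}^n x_k\big)_n$ is bounded, convergent, convergent to $0$, respectively, and $bv_1=\{x\in\omega:\sum_{k}|x_k-x_{k-1}|<\infty\}$ with $x_{-1}:=0$. For $\lambda,\mu\subseteq\omega$, $(\lambda,\mu)$ denotes the class of all infinite real matrices $A=(a_{nk})$ such that for every $x\in\lambda$ the series $A_n(x)=\sum_{k=0}^\infty a_{nk}x_k$ converges for each $n\in\mathbb{N}$ and the sequence $Ax=(A_n(x))_{n\in\mathbb{N}}$ belongs to $\mu$. *)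

theory Defs
  imports Complex_Main "HOL-Number_Theory.Fib"
begin

type_synonym real_seq = "nat \<Rightarrow> real"
type_synonym inf_matrix = "nat \<Rightarrow> nat \<Rightarrow> real"

text \<open>The sequence 1, 1, 2, 3, 5, \<dots>; the library's \<open>fib\<close> starts with 0, 1, so it is shifted by one.\<close>

definition fb :: "nat \<Rightarrow> real" where
  "fb n = real (fib (Suc n))"

lemma fb_0: "fb 0 = 1" and fb_1: "fb 1 = 1"
  and fb_rec: "n \<ge> 2 \<Longrightarrow> fb n = fb (n - 1) + fb (n - 2)"
proof -
  show "fb 0 = 1" "fb 1 = 1"
    by (simp_all add: fb_def)
  show "fb n = fb (n - 1) + fb (n - 2)" if "n \<ge> 2"
  proof -
    from that obtain k where "n = Suc (Suc k)"
      by (metis Suc_le_D numeral_2_eq_2 Suc_le_mono)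
    then show ?thesis
      by (simp add: fb_def)
  qed
qed


section \<open>Sequence spaces\<close>

definition null_seqs :: "real_seq set" where
  "null_seqs = {x. x \<longlonglongrightarrow> 0}"

definition conv_seqs :: "real_seq set" where
  "conv_seqs = {x. convergent x}"

definition bounded_seqs :: "real_seq set" where
  "bounded_seqs = {x. Bseq x}"

definition l1_seqs :: "real_seq set" where
  "l1_seqs = {x. summable (\<lambda>k. \<bar>x k\<bar>)}"

definition bs_seqs :: "real_seq set" where
  "bs_seqs = {x. Bseq (\<lambda>n. \<Sum>k\<le>n. x k)}"

definition cs_seqs :: "real_seq set" where
  "cs_seqs = {x. convergent (\<lambda>n. \<Sum>k\<le>n. x k)}"

definition cs0_seqs :: "real_seq set" where
  "cs0_seqs = {x. (\<lambda>n. \<Sum>k\<le>n. x k) \<longlonglongrightarrow> 0}"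

definition bv1_seqs :: "real_seq set" where
  "bv1_seqs = {x. summable (\<lambda>k. \<bar>x k - (if k = 0 then 0 else x (k - 1))\<bar>)}"

definition Fhat :: "real_seq \<Rightarrow> real_seq" where
  "Fhat x n = (if n = 0 then x 0
     else fb n / fb (n + 1) * x n - fb (n + 1) / fb n * x (n - 1))"

definition conv_Fhat :: "real_seq set" where
  "conv_Fhat = {x. Fhat x \<in> conv_seqs}"


section \<open>Matrix classes\<close>

definition matrix_class :: "real_seq set \<Rightarrow> real_seq set \<Rightarrow> inf_matrix set" where
  "matrix_class X Y = {A. \<forall>x\<in>X. (\<forall>n. summable (\<lambda>k. A n k * x k)) \<and>
                                 (\<lambda>n. \<Sum>k. A n k * x k) \<in> Y}"

definition sum_matrix :: "inf_matrix \<Rightarrow> inf_matrix" where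
  "sum_matrix A n k = (\<Sum>j\<le>n. A j k)"

definition diff_matrix :: "inf_matrix \<Rightarrow> inf_matrix" where
  "diff_matrix A n k = A n k - (if n = 0 then 0 else A (n - 1) k)"


section \<open>The conditions on a matrix\<close>

text \<open>\<open>dpart A n m k\<close> is \<open>d\<close> with subscripts \<open>m, k\<close> and superscript \<open>(n)\<close>.\<close>

definition dpart :: "inf_matrix \<Rightarrow> nat \<Rightarrow> nat \<Rightarrow> nat \<Rightarrow> real" where
  "dpart A n m k =
     (if k \<le> m then \<Sum>j=k..m. (fb (j + 1))\<^sup>2 / (fb k * fb (k + 1)) * A n j else 0)"

text \<open>The limits \<open>dlim\<close>, \<open>alpha_col\<close> and \<open>alpha_sum\<close> are only meaningful if they exist, as
  asserted by \<open>C2\<close>, \<open>C4\<close> and \<open>C7\<close> respectively.\<close>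

definition dlim :: "inf_matrix \<Rightarrow> nat \<Rightarrow> nat \<Rightarrow> real" where
  "dlim A n k = lim (\<lambda>m. dpart A n m k)"

definition alpha_col :: "inf_matrix \<Rightarrow> nat \<Rightarrow> real" where
  "alpha_col A k = lim (\<lambda>n. dlim A n k)"

definition alpha_sum :: "inf_matrix \<Rightarrow> real" where
  "alpha_sum A = lim (\<lambda>n. \<Sum>k. dlim A n k)"

definition C1 :: "inf_matrix \<Rightarrow> bool" where
  "C1 A \<longleftrightarrow> (\<forall>n. bdd_above (range (\<lambda>m. \<Sum>k\<le>m. \<bar>dpart A n m k\<bar>)))"

definition C2 :: "inf_matrix \<Rightarrow> bool" where
  "C2 A \<longleftrightarrow> (\<forall>n k. convergent (\<lambda>m. dpart A n m k))"

text \<open>A divergent real series has an unspecified value in HOL, so the convergence of the series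
  occurring in \<open>C3\<close> and \<open>C7\<close> is stated separately.\<close>

definition C3 :: "inf_matrix \<Rightarrow> bool" where
  "C3 A \<longleftrightarrow> (\<forall>n. summable (\<lambda>k. \<bar>dlim A n k\<bar>)) \<and>
            bdd_above (range (\<lambda>n. \<Sum>k. \<bar>dlim A n k\<bar>))"

definition C4 :: "inf_matrix \<Rightarrow> bool" where
  "C4 A \<longleftrightarrow> (\<forall>k. convergent (\<lambda>n. dlim A n k))"

definition C5 :: "inf_matrix \<Rightarrow> bool" where
  "C5 A \<longleftrightarrow> bdd_above {\<bar>\<Sum>n\<in>N. \<Sum>k\<in>K. dlim A n k\<bar> |N K. finite N \<and> finite K}"

definition C6 :: "inf_matrix \<Rightarrow> bool" where
  "C6 A \<longleftrightarrow> (\<forall>n. convergent (\<lambda>m. \<Sum>k\<le>m. dpart A n m k))"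

definition C7 :: "inf_matrix \<Rightarrow> bool" where
  "C7 A \<longleftrightarrow> (\<forall>n. summable (\<lambda>k. dlim A n k)) \<and> convergent (\<lambda>n. \<Sum>k. dlim A n k)"

end

theory Submission
  imports Defs
begin

text \<open>
  The operator \<^const>\<open>Fhat\<close> is a bijection of the space of all sequences, with an explicit
  inverse \<open>Finv\<close>.  Writing \<open>x = Finv y\<close> with \<open>y\<close> convergent and exchanging the order of summation
  turns the partial sums of \<open>\<Sum>k. A n k * x k\<close> into \<open>\<Sum>k\<le>m. dpart A n m k * y k\<close>, so everything
  depends on the triangular matrices \<^const>\<open>dpart\<close>.

  For a general triangular matrix with rows bounded in norm, convergent columns and convergent row
  sums, the limit of these sums as \<open>m\<close> grows
  would be \<open>\<Sum>k. dlim A n k * y k\<close> plus a multiple of \<open>lim y\<close>, the multiple being the defect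
  between the limit of the row sums and the sum of the column limits.  Here there is no defect,
  because \<open>dpart A n m k\<close> is the product of the weight \<open>1 / (fb k * fb (k + 1))\<close>, which is summable
  over \<open>k\<close>, and of a difference of two partial sums of the single series
  \<open>\<Sum>j. (fb (j + 1))\<^sup>2 * A n j\<close>.  The condition \<^const>\<open>C2\<close> says exactly that this series
  converges.  Its partial sums are then bounded, the weights dominate the rows, and \<^const>\<open>C1\<close>,
  \<^const>\<open>C6\<close> and the absolute summability of the rows of \<^const>\<open>dlim\<close> follow, as does the
  formula \<open>\<Sum>k. A n k * x k = \<Sum>k. dlim A n k * y k\<close>.  Testing with unit sequences \<open>y\<close> shows
  that \<^const>\<open>C2\<close> is also forced by membership in any of the classes.  Hence \<open>A\<close> maps
  \<^const>\<open>conv_Fhat\<close> into \<open>Y\<close> if and only if \<open>C2 A\<close> holds and \<open>dlim A\<close> maps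
  \<^const>\<open>conv_seqs\<close> into \<open>Y\<close>; this is \<open>matrix_class_conv_Fhat_iff\<close>.

  What is left are the classical characterisations of matrices with absolutely summable rows that
  map the convergent sequences into the bounded, convergent, null or absolutely summable ones.  The
  necessity of the norm bounds comes from a uniform boundedness principle
  (\<open>uniform_boundedness_null_seqs\<close>), the sufficiency from an approximation argument of Toeplitz
  type, and, for absolutely summable images, from splitting finite sums by sign.

  Finally, the target spaces given by partial sums or by differences reduce to these four, since
  \<^const>\<open>sum_matrix\<close> and \<^const>\<open>diff_matrix\<close> are inverse to each other and turn the image
  sequence into its partial sums and its differences, respectively.
\<close>

section \<open>Absolutely summable rows acting on bounded sequences\<close>

lemma summable_mult_bounded:
  fixes r x :: real_seq
  assumes "summable (\<lambda>k. \<bar>r k\<bar>)" and "\<And>k. \<bar>x k\<bar> \<le> B"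
  shows "summable (\<lambda>k. \<bar>r k * x k\<bar>)"
proof (rule summable_comparison_test')
  show "summable (\<lambda>k. \<bar>r k\<bar> * B)"
    by (rule summable_mult2[OF assms(1)])
  show "norm \<bar>r k * x k\<bar> \<le> \<bar>r k\<bar> * B" if "0 \<le> k" for k
    using assms(2) by (simp add: abs_mult mult_left_mono)
qed

lemma abs_suminf_mult_le:
  fixes r x :: real_seq
  assumes "summable (\<lambda>k. \<bar>r k\<bar>)" and "\<And>k. \<bar>x k\<bar> \<le> B"
  shows "\<bar>\<Sum>k. r k * x k\<bar> \<le> B * (\<Sum>k. \<bar>r k\<bar>)"
proof -
  have s: "summable (\<lambda>k. \<bar>r k * x k\<bar>)"
    using assms by (rule summable_mult_bounded)
  have "\<bar>\<Sum>k. r k * x k\<bar> \<le> (\<Sum>k. \<bar>r k * x k\<bar>)"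
    using s by (rule summable_rabs)
  also have "\<dots> \<le> (\<Sum>k. B * \<bar>r k\<bar>)"
  proof (rule suminf_le[OF _ s summable_mult[OF assms(1)]])
    show "\<bar>r k * x k\<bar> \<le> B * \<bar>r k\<bar>" for k
      using assms(2)[of k] by (simp add: abs_mult mult.commute[of B] mult_left_mono)
  qed
  also have "\<dots> = B * (\<Sum>k. \<bar>r k\<bar>)"
    by (rule suminf_mult[OF assms(1)])
  finally show ?thesis .
qed

lemma convergent_abs_bounded:
  fixes x :: real_seq
  assumes "convergent x"
  obtains B where "\<And>k. \<bar>x k\<bar> \<le> B"
  using convergent_imp_Bseq[OF assms] by (auto simp: Bseq_def)

lemma summable_mult_convergent:
  fixes r x :: real_seq
  assumes "summable (\<lambda>k. \<bar>r k\<bar>)" and "convergent x"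
  shows "summable (\<lambda>k. r k * x k)"
  by (metis assms convergent_abs_bounded summable_mult_bounded summable_rabs_cancel)

lemma Bseq_abs_iff:
  fixes x :: real_seq
  shows "Bseq x \<longleftrightarrow> (\<exists>B. \<forall>n. \<bar>x n\<bar> \<le> B)"
  by (metis BseqI' Bseq_def real_norm_def)


section \<open>A uniform boundedness principle\<close>

text \<open>
  The norm of a row as a functional is attained in the limit along truncated sign patterns.
  Finite support keeps such a pattern within the null sequences.
\<close>

lemma norming_sequence:
  fixes r :: real_seq
  assumes r: "summable (\<lambda>k. \<bar>r k\<bar>)" and c: "c < (\<Sum>k. \<bar>r k\<bar>)"
  obtains \<xi> :: real_seq and K :: nat where "\<And>k. \<bar>\<xi> k\<bar> \<le> 1" "\<And>k. K \<le> k \<Longrightarrow> \<xi> k = 0"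
    "c \<le> (\<Sum>k. r k * \<xi> k)"
proof -
  have "(\<lambda>K. \<Sum>k<K. \<bar>r k\<bar>) \<longlonglongrightarrow> (\<Sum>k. \<bar>r k\<bar>)"
    using r by (rule summable_LIMSEQ)
  then have "\<forall>\<^sub>F K in sequentially. c < (\<Sum>k<K. \<bar>r k\<bar>)"
    using c by (rule order_tendstoD)
  then obtain K where K: "c < (\<Sum>k<K. \<bar>r k\<bar>)"
    by (auto simp: eventually_sequentially)
  define \<xi> :: real_seq where "\<xi> k = (if k < K then sgn (r k) else 0)" for k
  have "(\<Sum>k. r k * \<xi> k) = (\<Sum>k<K. r k * \<xi> k)"
    by (rule suminf_finite) (auto simp: \<xi>_def)
  also have "\<dots> = (\<Sum>k<K. \<bar>r k\<bar>)"
    by (rule sum.cong) (auto simp: \<xi>_def abs_sgn)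
  finally have "c \<le> (\<Sum>k. r k * \<xi> k)"
    using K by simp
  moreover have "\<bar>\<xi> k\<bar> \<le> 1" for k
    by (auto simp: \<xi>_def sgn_if)
  ultimately show thesis
    using that[of \<xi> K] by (auto simp: \<xi>_def)
qed

text \<open>
  A perturbation of size \<open>\<delta>\<close> makes the functional large wherever it starts: of the two values at
  \<open>q + \<delta> * \<xi>\<close> and \<open>q - \<delta> * \<xi>\<close>, one has modulus at least that of \<open>\<delta> * (\<Sum>k. r k * \<xi> k)\<close>, because the sign of
  the perturbation can be matched to the value at \<open>q\<close>.
\<close>

lemma hump_step:
  fixes r q :: real_seq
  assumes r: "summable (\<lambda>k. \<bar>r k\<bar>)" and pos: "0 < (\<Sum>k. \<bar>r k\<bar>)" and \<delta>: "0 < \<delta>"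
    and q: "\<forall>\<^sub>F k in sequentially. q k = 0"
  obtains q' :: real_seq where "\<forall>\<^sub>F k in sequentially. q' k = 0" "\<And>k. \<bar>q' k - q k\<bar> \<le> \<delta>"
    "\<delta> * (3 / 4 * (\<Sum>k. \<bar>r k\<bar>)) \<le> \<bar>\<Sum>k. r k * q' k\<bar>"
proof -
  obtain \<xi> :: real_seq and K where \<xi>: "\<And>k. \<bar>\<xi> k\<bar> \<le> 1" "\<And>k. K \<le> k \<Longrightarrow> \<xi> k = 0"
    "3 / 4 * (\<Sum>k. \<bar>r k\<bar>) \<le> (\<Sum>k. r k * \<xi> k)"
    using norming_sequence[OF r, of "3 / 4 * (\<Sum>k. \<bar>r k\<bar>)"] pos by auto
  define s :: real where "s = (if 0 \<le> (\<Sum>k. r k * q k) then 1 else -1)"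
  define q' :: real_seq where "q' k = q k + s * \<delta> * \<xi> k" for k
  have ev: "\<forall>\<^sub>F k in sequentially. \<xi> k = 0"
    using \<xi>(2) by (auto simp: eventually_sequentially)
  have sq: "summable (\<lambda>k. r k * q k)"
    by (rule summable_mult_convergent[OF r])
      (use q in \<open>auto simp: convergent_def intro: tendsto_eventually\<close>)
  have s\<xi>: "summable (\<lambda>k. r k * \<xi> k)"
    by (rule summable_mult_convergent[OF r])
      (use ev in \<open>auto simp: convergent_def intro: tendsto_eventually\<close>)
  have "(\<Sum>k. r k * q' k) = (\<Sum>k. r k * q k + s * \<delta> * (r k * \<xi> k))"
    by (simp add: q'_def algebra_simps)
  also have "\<dots> = (\<Sum>k. r k * q k) + s * \<delta> * (\<Sum>k. r k * \<xi> k)"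
    using sq s\<xi> by (simp add: suminf_add[symmetric] suminf_mult summable_mult)
  finally have eq: "(\<Sum>k. r k * q' k) = (\<Sum>k. r k * q k) + s * \<delta> * (\<Sum>k. r k * \<xi> k)" .
  have "0 \<le> \<delta> * (3 / 4 * (\<Sum>k. \<bar>r k\<bar>))"
    using \<delta> pos by simp
  moreover have "\<delta> * (3 / 4 * (\<Sum>k. \<bar>r k\<bar>)) \<le> \<delta> * (\<Sum>k. r k * \<xi> k)"
    using \<delta> \<xi>(3) by (intro mult_left_mono) auto
  ultimately have "\<delta> * (3 / 4 * (\<Sum>k. \<bar>r k\<bar>)) \<le> \<bar>\<Sum>k. r k * q' k\<bar>"
    unfolding eq by (auto simp: s_def)
  moreover have "\<forall>\<^sub>F k in sequentially. q' k = 0"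
    using q ev by eventually_elim (simp add: q'_def)
  moreover have "\<bar>q' k - q k\<bar> \<le> \<delta>" for k
    using \<delta> \<xi>(1)[of k] by (auto simp: q'_def s_def abs_mult)
  ultimately show thesis
    using that by blast
qed

text \<open>
  An elementary substitute for a Baire category argument.  If the norms are unbounded, pick
  functionals of norm greater than \<open>4 ^ n\<close> and build a null sequence by successive perturbations of
  size \<open>(1 / 3) ^ n\<close>, the \<open>n\<close>-th one making the modulus of the \<open>n\<close>-th functional
  at least \<open>3 / 4 * (1 / 3) ^ n\<close> times its norm.  All later perturbations together have size at most
  \<open>1 / 2 * (1 / 3) ^ n\<close>, so they can cancel only part of that value: at the limit sequence the
  modulus of the \<open>n\<close>-th functional is still at least \<open>(4 / 3) ^ n / 4\<close>.
\<close>

lemma uniform_boundedness_null_seqs: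
  fixes r :: "'i \<Rightarrow> real_seq"
  assumes r: "\<And>i. i \<in> I \<Longrightarrow> summable (\<lambda>k. \<bar>r i k\<bar>)"
    and bd: "\<And>x. x \<longlonglongrightarrow> 0 \<Longrightarrow> \<exists>B. \<forall>i\<in>I. \<bar>\<Sum>k. r i k * x k\<bar> \<le> B"
  shows "\<exists>B. \<forall>i\<in>I. (\<Sum>k. \<bar>r i k\<bar>) \<le> B"
proof (rule ccontr)
  assume "\<nexists>B. \<forall>i\<in>I. (\<Sum>k. \<bar>r i k\<bar>) \<le> B"
  then have "\<forall>n. \<exists>i. i \<in> I \<and> (4::real) ^ n < (\<Sum>k. \<bar>r i k\<bar>)"
    by (meson not_le)
  then obtain i where i: "\<And>n. i n \<in> I" "\<And>n. (4::real) ^ n < (\<Sum>k. \<bar>r (i n) k\<bar>)"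
    by metis
  have pos: "0 < (\<Sum>k. \<bar>r (i n) k\<bar>)" for n
    using i(2)[of n] by (meson less_trans zero_less_numeral zero_less_power)
  have "\<exists>p. \<forall>n. (\<forall>\<^sub>F k in sequentially. (p n :: real_seq) k = 0) \<and>
     ((\<forall>k. \<bar>p (Suc n) k - p n k\<bar> \<le> (1 / 3) ^ n) \<and>
      (1 / 3) ^ n * (3 / 4 * (\<Sum>k. \<bar>r (i n) k\<bar>)) \<le> \<bar>\<Sum>k. r (i n) k * p (Suc n) k\<bar>)"
  proof (rule dependent_nat_choice)
    show "\<exists>q::real_seq. \<forall>\<^sub>F k in sequentially. q k = 0"
      by (intro exI[of _ "\<lambda>_. 0"]) simp
    show "\<exists>q'. (\<forall>\<^sub>F k in sequentially. q' k = 0) \<and>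
       ((\<forall>k. \<bar>q' k - q k\<bar> \<le> (1 / 3) ^ n) \<and>
        (1 / 3) ^ n * (3 / 4 * (\<Sum>k. \<bar>r (i n) k\<bar>)) \<le> \<bar>\<Sum>k. r (i n) k * q' k\<bar>)"
      if "\<forall>\<^sub>F k in sequentially. q k = 0" for q :: real_seq and n
    proof -
      have \<delta>: "0 < (1 / 3 :: real) ^ n"
        by simp
      show ?thesis
        by (rule hump_step[OF r[OF i(1)] pos \<delta> that, of n]) blast
    qed
  qed
  then obtain p :: "nat \<Rightarrow> real_seq" where p: "\<And>n. \<forall>\<^sub>F k in sequentially. p n k = 0"
    "\<And>n k. \<bar>p (Suc n) k - p n k\<bar> \<le> (1 / 3) ^ n"
    "\<And>n. (1 / 3) ^ n * (3 / 4 * (\<Sum>k. \<bar>r (i n) k\<bar>)) \<le> \<bar>\<Sum>k. r (i n) k * p (Suc n) k\<bar>"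
    by blast
  have geo: "summable (\<lambda>j. (1 / 3 :: real) ^ j)"
    by (rule summable_geometric) simp
  have su: "summable (\<lambda>j. \<bar>p (Suc j) k - p j k\<bar>)" for k
    by (rule summable_comparison_test'[OF geo]) (use p(2) in auto)
  define x :: real_seq where "x k = p 0 k + (\<Sum>j. p (Suc j) k - p j k)" for k
  \<comment> \<open>At index \<open>Suc n\<close> this bound is half the size \<open>(1 / 3) ^ n\<close> of the perturbation just made.\<close>
  have close: "\<bar>x k - p n k\<bar> \<le> (1 / 3) ^ n * (3 / 2)" for n k
  proof -
    have "(\<Sum>j<n. p (Suc j) k - p j k) = p n k - p 0 k"
      by (rule sum_lessThan_telescope)
    then have "x k - p n k = (\<Sum>j. p (Suc (j + n)) k - p (j + n) k)"
      unfolding x_def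
      using suminf_minus_initial_segment[OF summable_rabs_cancel[OF su], of n k] by simp
    also have "\<bar>\<dots>\<bar> \<le> (\<Sum>j. \<bar>p (Suc (j + n)) k - p (j + n) k\<bar>)"
      using su[of k] by (intro summable_rabs) (rule summable_ignore_initial_segment)
    also have "\<dots> \<le> (\<Sum>j. (1 / 3) ^ (j + n))"
      using su[of k] geo p(2)
      by (intro suminf_le summable_ignore_initial_segment[of _ n]) auto
    also have "\<dots> = (1 / 3) ^ n * (3 / 2)"
      using suminf_mult[OF geo, of "(1 / 3) ^ n"] suminf_geometric[of "1 / 3 :: real"]
      by (simp add: power_add mult.commute)
    finally show ?thesis .
  qed
  have "x \<longlonglongrightarrow> 0"
  proof (rule LIMSEQ_I)
    fix e :: real
    assume "0 < e"
    then obtain n where "(1 / 3 :: real) ^ n < e / 2"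
      using real_arch_pow_inv[of "e / 2" "1 / 3"] by auto
    moreover have "\<forall>\<^sub>F k in sequentially. p n k = 0"
      by (rule p(1))
    then obtain K where "\<forall>k\<ge>K. p n k = 0"
      by (auto simp: eventually_sequentially)
    ultimately have "norm (x k - 0) < e" if "k \<ge> K" for k
      using close[of k n] that by simp
    then show "\<exists>K. \<forall>k\<ge>K. norm (x k - 0) < e"
      by blast
  qed
  then obtain B where "\<forall>i\<in>I. \<bar>\<Sum>k. r i k * x k\<bar> \<le> B"
    using bd by blast
  then have B: "\<bar>\<Sum>k. r (i n) k * x k\<bar> \<le> B" for n
    using i(1) by blast
  have low: "(4 / 3) ^ n / 4 \<le> B" for n
  proof -
    let ?r = "r (i n)" and ?N = "\<Sum>k. \<bar>r (i n) k\<bar>" and ?q = "p (Suc n)"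
    have sr: "summable (\<lambda>k. \<bar>?r k\<bar>)"
      using r i(1) .
    have dist: "\<bar>x k - ?q k\<bar> \<le> (1 / 3) ^ n / 2" for k
      using close[of k "Suc n"] by simp
    have sq: "summable (\<lambda>k. ?r k * ?q k)"
      using sr tendsto_eventually[OF p(1)] by (intro summable_mult_convergent) (auto simp: convergent_def)
    have sx: "summable (\<lambda>k. ?r k * x k)"
      using sr \<open>x \<longlonglongrightarrow> 0\<close> by (intro summable_mult_convergent) (auto simp: convergent_def)
    have "(\<Sum>k. ?r k * x k) - (\<Sum>k. ?r k * ?q k) = (\<Sum>k. ?r k * (x k - ?q k))"
      using suminf_diff[OF sx sq] by (simp add: algebra_simps)
    then have "\<bar>(\<Sum>k. ?r k * x k) - (\<Sum>k. ?r k * ?q k)\<bar> \<le> (1 / 3) ^ n / 2 * ?N"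
      using abs_suminf_mult_le[OF sr dist] by simp
    then have "(1 / 3) ^ n * ?N / 4 \<le> \<bar>\<Sum>k. ?r k * x k\<bar>"
      using p(3)[of n] by (simp only: mult.left_commute[of _ "3 / 4"])
    moreover have "(1 / 3) ^ n * (4::real) ^ n \<le> (1 / 3) ^ n * ?N"
      using i(2)[of n] by (intro mult_left_mono) auto
    moreover have "(1 / 3) ^ n * (4::real) ^ n = (4 / 3) ^ n"
      by (simp flip: power_mult_distrib)
    ultimately show ?thesis
      using B[of n] by linarith
  qed
  obtain n where "4 * B < (4 / 3 :: real) ^ n"
    using real_arch_pow[of "4 / 3" "4 * B"] by auto
  with low[of n] show False
    by simp
qed


section \<open>Matrices with absolutely summable rows on the space of convergent sequences\<close>

text \<open>
  Beyond some \<open>K\<close> the entries of \<open>x\<close> are small, and the uniform bound on the rows makes the tail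
  contribution small for all \<open>n\<close> at once; the remaining finitely many columns tend to \<open>0\<close>.
\<close>

lemma tendsto_suminf_mult_zero_columns:
  fixes D :: inf_matrix
  assumes D: "\<And>n. summable (\<lambda>k. \<bar>D n k\<bar>)" and M: "\<And>n. (\<Sum>k. \<bar>D n k\<bar>) \<le> M"
    and col: "\<And>k. (\<lambda>n. D n k) \<longlonglongrightarrow> 0" and x: "x \<longlonglongrightarrow> 0"
  shows "(\<lambda>n. \<Sum>k. D n k * x k) \<longlonglongrightarrow> 0"
proof (rule LIMSEQ_I)
  fix e :: real
  assume e: "0 < e"
  have "0 \<le> M"
    using M[of 0] suminf_nonneg[OF D[of 0]] by simp
  define \<delta> where "\<delta> = e / (2 * (M + 1))"
  have \<delta>: "0 < \<delta>" "\<delta> * M < e / 2"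
    using e \<open>0 \<le> M\<close> by (auto simp: \<delta>_def field_simps)
  obtain K where K: "\<And>k. k \<ge> K \<Longrightarrow> \<bar>x k\<bar> < \<delta>"
    using LIMSEQ_D[OF x \<delta>(1)] by auto
  define y where "y k = (if k < K then 0 else x k)" for k
  have y: "\<bar>y k\<bar> \<le> \<delta>" for k
    using K[of k] \<delta>(1) by (auto simp: y_def)
  have split: "(\<Sum>k. D n k * x k) = (\<Sum>k<K. D n k * x k) + (\<Sum>k. D n k * y k)" for n
  proof -
    have sx: "summable (\<lambda>k. D n k * x k)"
      using x by (intro summable_mult_convergent[OF D]) (auto simp: convergent_def)
    have sy: "summable (\<lambda>k. D n k * y k)"
      using summable_mult_bounded[OF D y] by (rule summable_rabs_cancel)
    have "(\<Sum>k. D n k * x k) - (\<Sum>k. D n k * y k) = (\<Sum>k. D n k * x k - D n k * y k)"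
      by (rule suminf_diff[OF sx sy])
    also have "\<dots> = (\<Sum>k<K. D n k * x k - D n k * y k)"
      by (rule suminf_finite) (auto simp: y_def)
    also have "\<dots> = (\<Sum>k<K. D n k * x k)"
      by (rule sum.cong) (auto simp: y_def)
    finally show ?thesis
      by simp
  qed
  have "(\<lambda>n. \<Sum>k<K. D n k * x k) \<longlonglongrightarrow> (\<Sum>k<K. 0 * x k)"
    by (intro tendsto_intros col)
  then obtain n0 where n0: "\<And>n. n \<ge> n0 \<Longrightarrow> \<bar>\<Sum>k<K. D n k * x k\<bar> < e / 2"
    using LIMSEQ_D[of _ 0 "e / 2"] e by force
  have "\<bar>\<Sum>k. D n k * x k\<bar> < e" if "n \<ge> n0" for n
  proof -
    have "\<bar>\<Sum>k. D n k * y k\<bar> \<le> \<delta> * (\<Sum>k. \<bar>D n k\<bar>)"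
      by (rule abs_suminf_mult_le[OF D y])
    also have "\<dots> \<le> \<delta> * M"
      using M \<delta>(1) by (intro mult_left_mono) auto
    finally show ?thesis
      using n0[OF that] \<delta>(2) unfolding split by linarith
  qed
  then show "\<exists>n0. \<forall>n\<ge>n0. norm ((\<Sum>k. D n k * x k) - 0) < e"
    by auto
qed

lemma summable_column_limits:
  fixes D :: inf_matrix
  assumes D: "\<And>n. summable (\<lambda>k. \<bar>D n k\<bar>)" and M: "\<And>n. (\<Sum>k. \<bar>D n k\<bar>) \<le> M"
    and col: "\<And>k. (\<lambda>n. D n k) \<longlonglongrightarrow> a k"
  shows "summable (\<lambda>k. \<bar>a k\<bar>)" and "(\<Sum>k. \<bar>a k\<bar>) \<le> M"
proof -
  have bound: "(\<Sum>k<K. \<bar>a k\<bar>) \<le> M" for K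
  proof (rule tendsto_upperbound)
    show "(\<lambda>n. \<Sum>k<K. \<bar>D n k\<bar>) \<longlonglongrightarrow> (\<Sum>k<K. \<bar>a k\<bar>)"
      by (intro tendsto_intros col)
    have "(\<Sum>k<K. \<bar>D n k\<bar>) \<le> M" for n
      using sum_le_suminf[OF D, of "{..<K}" n] M[of n] by simp
    then show "\<forall>\<^sub>F n in sequentially. (\<Sum>k<K. \<bar>D n k\<bar>) \<le> M"
      by simp
  qed simp
  then show "summable (\<lambda>k. \<bar>a k\<bar>)"
    by (intro summableI_nonneg_bounded[where x = M]) auto
  then show "(\<Sum>k. \<bar>a k\<bar>) \<le> M"
    using bound by (rule suminf_le_const)
qed

text \<open>
  Subtracting the column limits from the matrix and \<open>l\<close> from the sequence reduces this to columns
  and a sequence that tend to \<open>0\<close>; the row sums account for the constant sequence \<open>l\<close>.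
\<close>

lemma tendsto_suminf_mult_convergent:
  fixes D :: inf_matrix
  assumes D: "\<And>n. summable (\<lambda>k. \<bar>D n k\<bar>)" and M: "\<And>n. (\<Sum>k. \<bar>D n k\<bar>) \<le> M"
    and col: "\<And>k. (\<lambda>n. D n k) \<longlonglongrightarrow> a k" and row: "(\<lambda>n. \<Sum>k. D n k) \<longlonglongrightarrow> s"
    and y: "y \<longlonglongrightarrow> l"
  shows "(\<lambda>n. \<Sum>k. D n k * y k) \<longlonglongrightarrow> (\<Sum>k. a k * (y k - l)) + s * l"
proof -
  define z where "z k = y k - l" for k
  have z: "z \<longlonglongrightarrow> 0"
    unfolding z_def using tendsto_diff[OF y tendsto_const[of l]] by simp
  then have cz: "convergent z"
    by (auto simp: convergent_def)
  note a = summable_column_limits[OF D M col]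
  have sz: "summable (\<lambda>k. D n k * z k)" and sD: "summable (\<lambda>k. D n k)" for n
    using summable_mult_convergent[OF D cz] summable_rabs_cancel[OF D] by auto
  have sa: "summable (\<lambda>k. a k * z k)"
    by (rule summable_mult_convergent[OF a(1) cz])
  define E where "E n k = D n k - a k" for n k
  have le: "\<bar>E n k\<bar> \<le> \<bar>D n k\<bar> + \<bar>a k\<bar>" for n k
    by (simp add: E_def)
  have sE: "summable (\<lambda>k. \<bar>E n k\<bar>)" for n
    by (rule summable_comparison_test'[OF summable_add[OF D[of n] a(1)]]) (use le in auto)
  have "(\<Sum>k. \<bar>E n k\<bar>) \<le> 2 * M" for n
  proof -
    have "(\<Sum>k. \<bar>E n k\<bar>) \<le> (\<Sum>k. \<bar>D n k\<bar> + \<bar>a k\<bar>)"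
      by (intro suminf_le le sE summable_add D a(1))
    also have "\<dots> = (\<Sum>k. \<bar>D n k\<bar>) + (\<Sum>k. \<bar>a k\<bar>)"
      using suminf_add[OF D a(1)] by simp
    also have "\<dots> \<le> 2 * M"
      using M[of n] a(2) by simp
    finally show ?thesis .
  qed
  moreover have "(\<lambda>n. E n k) \<longlonglongrightarrow> 0" for k
    unfolding E_def using tendsto_diff[OF col[of k] tendsto_const[of "a k"]] by simp
  ultimately have "(\<lambda>n. \<Sum>k. E n k * z k) \<longlonglongrightarrow> 0"
    using sE z by (intro tendsto_suminf_mult_zero_columns[where M = "2 * M"])
  then have "(\<lambda>n. (\<Sum>k. E n k * z k) + (\<Sum>k. a k * z k) + (\<Sum>k. D n k) * l)
      \<longlonglongrightarrow> 0 + (\<Sum>k. a k * z k) + s * l"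
    by (intro tendsto_intros row)
  moreover have "(\<Sum>k. D n k * y k) = (\<Sum>k. E n k * z k) + (\<Sum>k. a k * z k) + (\<Sum>k. D n k) * l" for n
  proof -
    have "(\<Sum>k. D n k * z k) - (\<Sum>k. a k * z k) = (\<Sum>k. E n k * z k)"
      using suminf_diff[OF sz sa] by (simp add: E_def algebra_simps)
    moreover have "(\<Sum>k. D n k * z k) + (\<Sum>k. D n k) * l = (\<Sum>k. D n k * z k + D n k * l)"
      using suminf_add[OF sz summable_mult2[OF sD]] suminf_mult2[OF sD] by simp
    ultimately show ?thesis
      by (simp add: z_def algebra_simps)
  qed
  ultimately show ?thesis
    by (simp add: z_def)
qed

lemma mem_matrix_class_conv_seqs_iff:
  assumes "\<And>n. summable (\<lambda>k. \<bar>D n k\<bar>)"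
  shows "D \<in> matrix_class conv_seqs Y \<longleftrightarrow> (\<forall>y. convergent y \<longrightarrow> (\<lambda>n. \<Sum>k. D n k * y k) \<in> Y)"
  using summable_mult_convergent[OF assms] by (auto simp: matrix_class_def conv_seqs_def)

lemma convergent_unit_seq: "convergent (\<lambda>j. of_bool (j = k) :: real)"
proof -
  have "\<forall>\<^sub>F j in sequentially. (of_bool (j = k) :: real) = 0"
    using eventually_gt_at_top[of k] by eventually_elim simp
  from tendsto_eventually[OF this] show ?thesis
    by (rule convergentI)
qed

lemma suminf_mult_unit_seq: "(\<Sum>j. r j * of_bool (j = k)) = (r k :: real)"
  using suminf_finite[of "{k}" "\<lambda>j. r j * of_bool (j = k)"] by simp

lemma matrix_class_conv_bounded_iff:
  fixes D :: inf_matrix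
  assumes D: "\<And>n. summable (\<lambda>k. \<bar>D n k\<bar>)"
  shows "D \<in> matrix_class conv_seqs bounded_seqs \<longleftrightarrow> bdd_above (range (\<lambda>n. \<Sum>k. \<bar>D n k\<bar>))"
proof
  assume L: "D \<in> matrix_class conv_seqs bounded_seqs"
  have "\<exists>B. \<forall>n\<in>UNIV. (\<Sum>k. \<bar>D n k\<bar>) \<le> B"
  proof (rule uniform_boundedness_null_seqs)
    fix x :: real_seq
    assume "x \<longlonglongrightarrow> 0"
    then have "convergent x"
      by (auto simp: convergent_def)
    then show "\<exists>B. \<forall>n\<in>UNIV. \<bar>\<Sum>k. D n k * x k\<bar> \<le> B"
      using L mem_matrix_class_conv_seqs_iff[OF D]
      by (auto simp: bounded_seqs_def Bseq_abs_iff)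
  qed (rule D)
  then show "bdd_above (range (\<lambda>n. \<Sum>k. \<bar>D n k\<bar>))"
    by (auto simp: bdd_above_def)
next
  assume "bdd_above (range (\<lambda>n. \<Sum>k. \<bar>D n k\<bar>))"
  then obtain M where M: "\<And>n. (\<Sum>k. \<bar>D n k\<bar>) \<le> M"
    by (auto simp: bdd_above_def)
  show "D \<in> matrix_class conv_seqs bounded_seqs"
    unfolding mem_matrix_class_conv_seqs_iff[OF D]
  proof (intro allI impI)
    fix y :: real_seq
    assume "convergent y"
    then obtain B where B: "\<And>k. \<bar>y k\<bar> \<le> B"
      using convergent_abs_bounded by blast
    have "0 \<le> B"
      using B[of 0] by simp
    have "\<bar>\<Sum>k. D n k * y k\<bar> \<le> B * M" for n
      using abs_suminf_mult_le[where x = y, OF D B, of n] mult_left_mono[OF M[of n] \<open>0 \<le> B\<close>] by linarith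
    then show "(\<lambda>n. \<Sum>k. D n k * y k) \<in> bounded_seqs"
      by (auto simp: bounded_seqs_def Bseq_abs_iff)
  qed
qed

lemma matrix_class_mono: "Y \<subseteq> Z \<Longrightarrow> matrix_class X Y \<subseteq> matrix_class X Z"
  by (auto simp: matrix_class_def)

lemma conv_seqs_subset_bounded_seqs: "conv_seqs \<subseteq> bounded_seqs"
  by (auto simp: conv_seqs_def bounded_seqs_def convergent_imp_Bseq)

lemma null_seqs_subset_conv_seqs: "null_seqs \<subseteq> conv_seqs"
  by (auto simp: conv_seqs_def null_seqs_def convergent_def)

lemma matrix_class_conv_conv_iff:
  fixes D :: inf_matrix
  assumes D: "\<And>n. summable (\<lambda>k. \<bar>D n k\<bar>)"
  shows "D \<in> matrix_class conv_seqs conv_seqs \<longleftrightarrow> bdd_above (range (\<lambda>n. \<Sum>k. \<bar>D n k\<bar>)) \<and>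
    (\<forall>k. convergent (\<lambda>n. D n k)) \<and> convergent (\<lambda>n. \<Sum>k. D n k)"
proof
  assume L: "D \<in> matrix_class conv_seqs conv_seqs"
  have "bdd_above (range (\<lambda>n. \<Sum>k. \<bar>D n k\<bar>))"
    using subsetD[OF matrix_class_mono[OF conv_seqs_subset_bounded_seqs] L]
    by (simp only: matrix_class_conv_bounded_iff[where D = D, OF D])
  moreover have *: "convergent (\<lambda>n. \<Sum>k. D n k * y k)" if "convergent y" for y
    using L that mem_matrix_class_conv_seqs_iff[OF D] by (auto simp: conv_seqs_def)
  have "convergent (\<lambda>n. D n k)" for k
    using *[OF convergent_unit_seq[of k]] by (simp only: suminf_mult_unit_seq)
  moreover have "convergent (\<lambda>n. \<Sum>k. D n k)"
    using *[OF convergent_const[of 1]] by simp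
  ultimately show "bdd_above (range (\<lambda>n. \<Sum>k. \<bar>D n k\<bar>)) \<and>
    (\<forall>k. convergent (\<lambda>n. D n k)) \<and> convergent (\<lambda>n. \<Sum>k. D n k)"
    by blast
next
  assume R: "bdd_above (range (\<lambda>n. \<Sum>k. \<bar>D n k\<bar>)) \<and>
    (\<forall>k. convergent (\<lambda>n. D n k)) \<and> convergent (\<lambda>n. \<Sum>k. D n k)"
  then obtain M where M: "\<And>n. (\<Sum>k. \<bar>D n k\<bar>) \<le> M"
    by (auto simp: bdd_above_def)
  have col: "(\<lambda>n. D n k) \<longlonglongrightarrow> lim (\<lambda>n. D n k)" for k
    using R by (simp add: convergent_LIMSEQ_iff)
  have row: "(\<lambda>n. \<Sum>k. D n k) \<longlonglongrightarrow> lim (\<lambda>n. \<Sum>k. D n k)"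
    using R by (simp add: convergent_LIMSEQ_iff)
  show "D \<in> matrix_class conv_seqs conv_seqs"
    unfolding mem_matrix_class_conv_seqs_iff[OF D]
    using tendsto_suminf_mult_convergent[OF D M col row] by (auto simp: conv_seqs_def convergent_def)
qed

lemma matrix_class_conv_null_iff:
  fixes D :: inf_matrix
  assumes D: "\<And>n. summable (\<lambda>k. \<bar>D n k\<bar>)"
  shows "D \<in> matrix_class conv_seqs null_seqs \<longleftrightarrow> bdd_above (range (\<lambda>n. \<Sum>k. \<bar>D n k\<bar>)) \<and>
    (\<forall>k. (\<lambda>n. D n k) \<longlonglongrightarrow> 0) \<and> (\<lambda>n. \<Sum>k. D n k) \<longlonglongrightarrow> 0"
proof
  assume L: "D \<in> matrix_class conv_seqs null_seqs"
  have "bdd_above (range (\<lambda>n. \<Sum>k. \<bar>D n k\<bar>))"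
    using subsetD[OF matrix_class_mono[OF null_seqs_subset_conv_seqs] L]
    by (simp only: matrix_class_conv_conv_iff[where D = D, OF D])
  moreover have *: "(\<lambda>n. \<Sum>k. D n k * y k) \<longlonglongrightarrow> 0" if "convergent y" for y
    using L that mem_matrix_class_conv_seqs_iff[OF D] by (auto simp: null_seqs_def)
  have "(\<lambda>n. D n k) \<longlonglongrightarrow> 0" for k
    using *[OF convergent_unit_seq[of k]] by (simp only: suminf_mult_unit_seq)
  moreover have "(\<lambda>n. \<Sum>k. D n k) \<longlonglongrightarrow> 0"
    using *[OF convergent_const[of 1]] by simp
  ultimately show "bdd_above (range (\<lambda>n. \<Sum>k. \<bar>D n k\<bar>)) \<and>
    (\<forall>k. (\<lambda>n. D n k) \<longlonglongrightarrow> 0) \<and> (\<lambda>n. \<Sum>k. D n k) \<longlonglongrightarrow> 0"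
    by blast
next
  assume R: "bdd_above (range (\<lambda>n. \<Sum>k. \<bar>D n k\<bar>)) \<and>
    (\<forall>k. (\<lambda>n. D n k) \<longlonglongrightarrow> 0) \<and> (\<lambda>n. \<Sum>k. D n k) \<longlonglongrightarrow> 0"
  then obtain M where M: "\<And>n. (\<Sum>k. \<bar>D n k\<bar>) \<le> M"
    by (auto simp: bdd_above_def)
  show "D \<in> matrix_class conv_seqs null_seqs"
    unfolding mem_matrix_class_conv_seqs_iff[OF D]
  proof (intro allI impI)
    fix y :: real_seq
    assume "convergent y"
    then obtain l where "y \<longlonglongrightarrow> l"
      by (auto simp: convergent_def)
    then show "(\<lambda>n. \<Sum>k. D n k * y k) \<in> null_seqs"
      using tendsto_suminf_mult_convergent[OF D M, where a = "\<lambda>_. 0" and s = 0] R by (simp add: null_seqs_def)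
  qed
qed

text \<open>
  The terms of either sign form a subset on which nothing cancels, hence the factor \<open>2\<close>.
\<close>

lemma sum_abs_le_by_sign_split:
  fixes f :: "'a \<Rightarrow> real"
  assumes "finite S" and "\<And>T. T \<subseteq> S \<Longrightarrow> \<bar>sum f T\<bar> \<le> B"
  shows "(\<Sum>s\<in>S. \<bar>f s\<bar>) \<le> 2 * B"
proof -
  let ?P = "{s \<in> S. 0 \<le> f s}" and ?N = "{s \<in> S. \<not> 0 \<le> f s}"
  have "(\<Sum>s\<in>S. \<bar>f s\<bar>) = (\<Sum>s\<in>S. if 0 \<le> f s then f s else - f s)"
    by (rule sum.cong) auto
  also have "\<dots> = sum f ?P - sum f ?N"
    using assms(1) by (simp add: sum.If_cases sum_negf Int_def)
  also have "\<dots> \<le> 2 * B"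
    using assms(2)[of ?P] assms(2)[of ?N] by auto
  finally show ?thesis .
qed

text \<open>
  The condition is symmetric in rows and columns but does not bound the double sum of absolute
  values, so rows and columns are treated one after the other.  For necessity, the uniform
  boundedness principle is applied to the family of all finite sums of rows.  For sufficiency, a
  sign split over the columns bounds every finite sum of rows in norm, and a second sign split over
  the rows then bounds the absolute sum of the image sequence.
\<close>

lemma matrix_class_conv_l1_iff:
  fixes D :: inf_matrix
  assumes D: "\<And>n. summable (\<lambda>k. \<bar>D n k\<bar>)"
  shows "D \<in> matrix_class conv_seqs l1_seqs \<longleftrightarrow>
    bdd_above {\<bar>\<Sum>n\<in>N. \<Sum>k\<in>K. D n k\<bar> |N K. finite N \<and> finite K}"
proof -
  have row: "summable (\<lambda>k. \<bar>\<Sum>n\<in>N. D n k\<bar>)" for N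
    by (rule summable_comparison_test'[OF summable_sum[of N "\<lambda>n k. \<bar>D n k\<bar>"]])
      (use D in auto)
  have row_sum: "(\<Sum>k. (\<Sum>n\<in>N. D n k) * x k) = (\<Sum>n\<in>N. \<Sum>k. D n k * x k)"
    if "convergent x" for N x
    using suminf_sum[of N "\<lambda>n k. D n k * x k"] summable_mult_convergent[OF D that]
    by (simp add: sum_distrib_right)
  show ?thesis
  proof
    assume L: "D \<in> matrix_class conv_seqs l1_seqs"
    have "\<exists>B. \<forall>N\<in>{N. finite N}. (\<Sum>k. \<bar>\<Sum>n\<in>N. D n k\<bar>) \<le> B"
    proof (rule uniform_boundedness_null_seqs)
      fix x :: real_seq
      assume "x \<longlonglongrightarrow> 0"
      then have x: "convergent x"
        by (auto simp: convergent_def)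
      then have s: "summable (\<lambda>n. \<bar>\<Sum>k. D n k * x k\<bar>)"
        using L mem_matrix_class_conv_seqs_iff[OF D] by (auto simp: l1_seqs_def)
      have "\<bar>\<Sum>k. (\<Sum>n\<in>N. D n k) * x k\<bar> \<le> (\<Sum>n. \<bar>\<Sum>k. D n k * x k\<bar>)" if "finite N" for N
        unfolding row_sum[OF x]
        by (rule order_trans[OF sum_abs sum_le_suminf[OF s that]]) simp
      then show "\<exists>B. \<forall>N\<in>{N. finite N}. \<bar>\<Sum>k. (\<Sum>n\<in>N. D n k) * x k\<bar> \<le> B"
        by auto
    qed (rule row)
    then obtain B where B: "\<And>N. finite N \<Longrightarrow> (\<Sum>k. \<bar>\<Sum>n\<in>N. D n k\<bar>) \<le> B"
      by auto
    have "\<bar>\<Sum>n\<in>N. \<Sum>k\<in>K. D n k\<bar> \<le> B" if "finite N" "finite K" for N K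
    proof -
      have "\<bar>\<Sum>n\<in>N. \<Sum>k\<in>K. D n k\<bar> \<le> (\<Sum>k\<in>K. \<bar>\<Sum>n\<in>N. D n k\<bar>)"
        using sum_abs[of "\<lambda>k. \<Sum>n\<in>N. D n k" K] by (simp only: sum.swap[of _ K N])
      also have "\<dots> \<le> (\<Sum>k. \<bar>\<Sum>n\<in>N. D n k\<bar>)"
        by (rule sum_le_suminf[OF row that(2)]) simp
      finally show ?thesis
        using B[OF that(1)] by linarith
    qed
    then show "bdd_above {\<bar>\<Sum>n\<in>N. \<Sum>k\<in>K. D n k\<bar> |N K. finite N \<and> finite K}"
      unfolding bdd_above_def by blast
  next
    assume "bdd_above {\<bar>\<Sum>n\<in>N. \<Sum>k\<in>K. D n k\<bar> |N K. finite N \<and> finite K}"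
    then obtain B where B: "\<And>N K. finite N \<Longrightarrow> finite K \<Longrightarrow> \<bar>\<Sum>n\<in>N. \<Sum>k\<in>K. D n k\<bar> \<le> B"
      unfolding bdd_above_def by blast
    have row_bound: "(\<Sum>k. \<bar>\<Sum>n\<in>N. D n k\<bar>) \<le> 2 * B" if "finite N" for N
    proof (rule suminf_le_const[OF row])
      fix m
      show "(\<Sum>k<m. \<bar>\<Sum>n\<in>N. D n k\<bar>) \<le> 2 * B"
      proof (rule sum_abs_le_by_sign_split)
        fix T
        assume "T \<subseteq> {..<m}"
        then have "finite T"
          by (rule finite_subset) simp
        then show "\<bar>\<Sum>k\<in>T. \<Sum>n\<in>N. D n k\<bar> \<le> B"
          using B[OF that] by (simp only: sum.swap[of _ N T])
      qed simp
    qed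
    show "D \<in> matrix_class conv_seqs l1_seqs"
      unfolding mem_matrix_class_conv_seqs_iff[OF D]
    proof (intro allI impI)
      fix y :: real_seq
      assume cy: "convergent y"
      then obtain b where b: "\<And>k. \<bar>y k\<bar> \<le> b"
        using convergent_abs_bounded by blast
      have "0 \<le> b"
        using b[of 0] by simp
      have sub: "\<bar>\<Sum>n\<in>N. \<Sum>k. D n k * y k\<bar> \<le> b * (2 * B)" if "finite N" for N
        using abs_suminf_mult_le[where x = y, OF row b, of N] mult_left_mono[OF row_bound[OF that] \<open>0 \<le> b\<close>]
        unfolding row_sum[OF cy] by linarith
      have "(\<Sum>n\<le>m. \<bar>\<Sum>k. D n k * y k\<bar>) \<le> 2 * (b * (2 * B))" for m
        by (rule sum_abs_le_by_sign_split) (auto intro: sub finite_subset)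
      then have "summable (\<lambda>n. \<bar>\<Sum>k. D n k * y k\<bar>)"
        by (intro bounded_imp_summable) auto
      then show "(\<lambda>n. \<Sum>k. D n k * y k) \<in> l1_seqs"
        by (simp add: l1_seqs_def)
    qed
  qed
qed


section \<open>Inverting the Fibonacci difference operator\<close>

lemma fb_pos: "0 < fb n"
  by (simp add: fb_def fib_neq_0_nat)

lemma fb_nonzero: "fb n \<noteq> 0"
  using fb_pos[of n] by simp

text \<open>
  The reciprocal factor in \<^const>\<open>dpart\<close>; its summability in \<open>k\<close> is what allows the
  limit over \<open>m\<close> and the sum over \<open>k\<close> to be exchanged.
\<close>

definition wt :: "nat \<Rightarrow> real" where
  "wt k = 1 / (fb k * fb (k + 1))"

lemma wt_pos: "0 < wt k"
  by (simp add: wt_def fb_pos)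

text \<open>
  For \<open>k \<ge> 1\<close> the weights are dominated by the telescoping differences
  \<open>1 / fb k - 1 / fb (k + 1) = fb (k - 1) * wt k\<close>.
\<close>

lemma summable_wt: "summable wt"
proof (rule summableI_nonneg_bounded)
  show "(\<Sum>k<n. wt k) \<le> 2" for n
  proof (cases n)
    case (Suc m)
    have tele: "wt (Suc k) \<le> 1 / fb (Suc k) - 1 / fb (Suc (Suc k))" for k
    proof -
      have "fb (Suc (Suc k)) - fb (Suc k) = fb k"
        by (simp add: fb_def)
      then have "1 / fb (Suc k) - 1 / fb (Suc (Suc k)) = fb k * wt (Suc k)"
        using fb_nonzero by (simp add: wt_def diff_frac_eq)
      moreover have "1 \<le> fb k"
        by (simp add: fb_def Suc_le_eq fib_neq_0_nat)
      ultimately show ?thesis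
        using wt_pos[of "Suc k"] by simp
    qed
    have "(\<Sum>k<n. wt k) = wt 0 + (\<Sum>k<m. wt (Suc k))"
      unfolding Suc by (rule sum.lessThan_Suc_shift)
    also have "\<dots> \<le> wt 0 + (\<Sum>k<m. 1 / fb (Suc k) - 1 / fb (Suc (Suc k)))"
      by (intro add_left_mono sum_mono tele)
    also have "\<dots> = wt 0 + (1 / fb 1 - 1 / fb (Suc m))"
      using sum_lessThan_telescope'[of "\<lambda>k. 1 / fb (Suc k)" m] by simp
    also have "\<dots> \<le> 2"
      using fb_pos[of "Suc m"] by (simp add: wt_def fb_0 fb_1[unfolded One_nat_def])
    finally show ?thesis .
  qed simp
qed (simp add: less_imp_le wt_pos)

lemma summable_abs_wt: "summable (\<lambda>k. \<bar>wt k\<bar>)"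
  using summable_wt wt_pos by (simp add: less_imp_le)

definition Finv :: "real_seq \<Rightarrow> real_seq" where
  "Finv y n = (\<Sum>k\<le>n. (fb (n + 1))\<^sup>2 * wt k * y k)"

lemma Finv_0: "Finv y 0 = y 0"
  by (simp add: Finv_def wt_def fb_0 fb_1[unfolded One_nat_def])

lemma Finv_Suc:
  "Finv y (Suc n) = fb (n + 2) / fb (n + 1) * y (Suc n) + (fb (n + 2) / fb (n + 1))\<^sup>2 * Finv y n"
proof -
  have "Finv y (Suc n) = (fb (n + 2))\<^sup>2 * wt (Suc n) * y (Suc n) + (\<Sum>k\<le>n. (fb (n + 2))\<^sup>2 * wt k * y k)"
    by (simp add: Finv_def)
  also have "(fb (n + 2))\<^sup>2 * wt (Suc n) = fb (n + 2) / fb (n + 1)"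
    using fb_nonzero by (simp add: wt_def power2_eq_square)
  also have "(\<Sum>k\<le>n. (fb (n + 2))\<^sup>2 * wt k * y k) = (fb (n + 2) / fb (n + 1))\<^sup>2 * Finv y n"
    using fb_nonzero[of "n + 1"] by (simp add: Finv_def sum_distrib_left power_divide mult.assoc)
  finally show ?thesis .
qed

lemma Fhat_Finv: "Fhat (Finv y) = y"
proof
  fix n
  show "Fhat (Finv y) n = y n"
  proof (cases n)
    case (Suc m)
    then show ?thesis
      using fb_nonzero[of "Suc m"] fb_nonzero[of "Suc (Suc m)"]
      by (simp add: Fhat_def Finv_Suc field_simps power2_eq_square)
  qed (simp add: Fhat_def Finv_0)
qed

lemma Finv_Fhat: "Finv (Fhat x) = x"
proof
  fix n
  show "Finv (Fhat x) n = x n"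
  proof (induction n)
    case (Suc n)
    then show ?case
      using fb_nonzero[of "Suc n"] fb_nonzero[of "Suc (Suc n)"]
      by (simp add: Finv_Suc Fhat_def field_simps power2_eq_square)
  qed (simp add: Finv_0 Fhat_def)
qed

lemma conv_Fhat_eq: "conv_Fhat = Finv ` conv_seqs"
proof
  show "conv_Fhat \<subseteq> Finv ` conv_seqs"
  proof
    fix x
    assume "x \<in> conv_Fhat"
    then show "x \<in> Finv ` conv_seqs"
      unfolding conv_Fhat_def by (intro image_eqI[of _ _ "Fhat x"]) (auto simp: Finv_Fhat)
  qed
qed (auto simp: conv_Fhat_def Fhat_Finv)


section \<open>Transporting a matrix along the inverse\<close>

text \<open>
  The partial sums of the one series per row that controls all the columns of \<^const>\<open>dpart\<close>.
\<close>

definition wsum :: "inf_matrix \<Rightarrow> nat \<Rightarrow> nat \<Rightarrow> real" where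
  "wsum A n i = (\<Sum>j<i. (fb (j + 1))\<^sup>2 * A n j)"

lemma dpart_eq_wsum:
  assumes "k \<le> m"
  shows "dpart A n m k = wt k * (wsum A n (Suc m) - wsum A n k)"
proof -
  have "wsum A n (Suc m) - wsum A n k = (\<Sum>j=k..m. (fb (j + 1))\<^sup>2 * A n j)"
    using assms sum_diff_nat_ivl[of 0 k "Suc m" "\<lambda>j. (fb (j + 1))\<^sup>2 * A n j"]
    by (simp add: wsum_def lessThan_atLeast0 atLeastLessThanSuc_atLeastAtMost)
  then show ?thesis
    using assms by (simp add: dpart_def wt_def sum_distrib_left)
qed

lemma sum_mult_Finv:
  "(\<Sum>j<Suc m. A n j * Finv y j) = (\<Sum>k\<le>m. dpart A n m k * y k)"
proof -
  have "(\<Sum>j\<le>m. A n j * Finv y j)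
      = (\<Sum>j\<le>m. \<Sum>k\<in>{k. k \<le> m \<and> k \<le> j}. (fb (j + 1))\<^sup>2 * wt k * A n j * y k)"
    by (rule sum.cong) (auto simp: Finv_def sum_distrib_left mult_ac intro!: sum.cong)
  also have "\<dots> = (\<Sum>k\<le>m. \<Sum>j\<in>{j. j \<le> m \<and> k \<le> j}. (fb (j + 1))\<^sup>2 * wt k * A n j * y k)"
    using sum.swap_restrict[of "{..m}" "{..m}" "\<lambda>j k. (fb (j + 1))\<^sup>2 * wt k * A n j * y k" "\<lambda>j k. k \<le> j"]
    by simp
  also have "\<dots> = (\<Sum>k\<le>m. dpart A n m k * y k)"
    by (rule sum.cong) (auto simp: dpart_def wt_def sum_distrib_right intro!: sum.cong)
  finally show ?thesis
    by (simp only: lessThan_Suc_atMost)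
qed

lemma tendsto_dpart:
  assumes g: "wsum A n \<longlonglongrightarrow> g"
  shows "(\<lambda>m. dpart A n m k) \<longlonglongrightarrow> wt k * (g - wsum A n k)"
proof (rule Lim_transform_eventually)
  show "(\<lambda>m. wt k * (wsum A n (Suc m) - wsum A n k)) \<longlonglongrightarrow> wt k * (g - wsum A n k)"
    by (intro tendsto_intros LIMSEQ_Suc[OF g])
  show "\<forall>\<^sub>F m in sequentially. wt k * (wsum A n (Suc m) - wsum A n k) = dpart A n m k"
    using eventually_ge_at_top[of k] by eventually_elim (simp add: dpart_eq_wsum)
qed

text \<open>
  Column \<open>0\<close> alone already determines the convergence, since its entries are the partial sums
  themselves.
\<close>

lemma C2_iff_convergent_wsum: "C2 A \<longleftrightarrow> (\<forall>n. convergent (wsum A n))"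
proof
  assume L: "C2 A"
  show "\<forall>n. convergent (wsum A n)"
  proof
    fix n
    have "convergent (\<lambda>m. dpart A n m 0)"
      using L by (simp add: C2_def)
    then have "convergent (\<lambda>m. wsum A n (Suc m))"
      by (simp add: dpart_eq_wsum wt_def fb_0 fb_1[unfolded One_nat_def]) (simp add: wsum_def)
    then show "convergent (wsum A n)"
      by (simp only: convergent_Suc_iff)
  qed
next
  assume R: "\<forall>n. convergent (wsum A n)"
  then show "C2 A"
    unfolding C2_def convergent_def[of "wsum A _"] by (blast intro: convergentI tendsto_dpart)
qed

lemma dlim_eq_wsum: "wsum A n \<longlonglongrightarrow> g \<Longrightarrow> dlim A n k = wt k * (g - wsum A n k)"
  unfolding dlim_def by (intro limI tendsto_dpart)

lemma C2_imp_summable_dlim: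
  assumes "C2 A"
  shows "summable (\<lambda>k. \<bar>dlim A n k\<bar>)"
proof -
  obtain g where g: "wsum A n \<longlonglongrightarrow> g"
    using assms by (auto simp: C2_iff_convergent_wsum convergent_def)
  have "convergent (\<lambda>k. g - wsum A n k)"
    using g by (intro convergent_diff convergent_const) (rule convergentI)
  then obtain B where "\<And>k. \<bar>g - wsum A n k\<bar> \<le> B"
    using convergent_abs_bounded by blast
  then show ?thesis
    unfolding dlim_eq_wsum[OF g] by (rule summable_mult_bounded[OF summable_abs_wt])
qed

lemma C2_imp_C1:
  assumes "C2 A"
  shows "C1 A"
  unfolding C1_def
proof
  fix n
  have "convergent (wsum A n)"
    using assms by (simp add: C2_iff_convergent_wsum)
  then obtain B where B: "\<And>i. \<bar>wsum A n i\<bar> \<le> B"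
    using convergent_abs_bounded by blast
  have "(\<Sum>k\<le>m. \<bar>dpart A n m k\<bar>) \<le> (\<Sum>k. wt k) * (2 * B)" for m
  proof -
    have "(\<Sum>k\<le>m. \<bar>dpart A n m k\<bar>) \<le> (\<Sum>k\<le>m. wt k * (2 * B))"
    proof (rule sum_mono)
      fix k
      assume "k \<in> {..m}"
      then have "\<bar>dpart A n m k\<bar> = wt k * \<bar>wsum A n (Suc m) - wsum A n k\<bar>"
        using wt_pos[of k] by (simp add: dpart_eq_wsum abs_mult)
      also have "\<dots> \<le> wt k * (2 * B)"
        using B[of "Suc m"] B[of k] wt_pos[of k] by (intro mult_left_mono) auto
      finally show "\<bar>dpart A n m k\<bar> \<le> wt k * (2 * B)" .
    qed
    also have "\<dots> = (\<Sum>k\<le>m. wt k) * (2 * B)"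
      by (simp add: sum_distrib_right)
    also have "\<dots> \<le> (\<Sum>k. wt k) * (2 * B)"
      using B[of 0] sum_le_suminf[OF summable_wt, of "{..m}"] wt_pos
      by (intro mult_right_mono) (auto simp: less_imp_le)
    finally show ?thesis .
  qed
  then show "bdd_above (range (\<lambda>m. \<Sum>k\<le>m. \<bar>dpart A n m k\<bar>))"
    unfolding bdd_above_def by blast
qed

text \<open>
  The difference in \<open>dpart_eq_wsum\<close> splits the sum into a convergent factor times a partial sum of
  \<open>\<Sum>k. wt k * y k\<close>, and a partial sum of an absolutely convergent series.  Both limits exist, so
  limit and summation may be interchanged without a term involving \<open>lim y\<close>.
\<close>

lemma tendsto_sum_dpart_mult:
  assumes "C2 A" and y: "convergent y"
  shows "(\<lambda>m. \<Sum>k\<le>m. dpart A n m k * y k) \<longlonglongrightarrow> (\<Sum>k. dlim A n k * y k)"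
proof -
  obtain g where g: "wsum A n \<longlonglongrightarrow> g"
    using assms by (auto simp: C2_iff_convergent_wsum convergent_def)
  have s1: "summable (\<lambda>k. wt k * y k)"
    by (rule summable_mult_convergent[OF summable_abs_wt y])
  have "convergent (\<lambda>k. wsum A n k * y k)"
    using g by (intro convergent_mult y) (rule convergentI)
  then have s2: "summable (\<lambda>k. wt k * (wsum A n k * y k))"
    by (rule summable_mult_convergent[OF summable_abs_wt])
  have "(\<lambda>m. wsum A n (Suc m) * (\<Sum>k\<le>m. wt k * y k) - (\<Sum>k\<le>m. wt k * (wsum A n k * y k)))
      \<longlonglongrightarrow> g * (\<Sum>k. wt k * y k) - (\<Sum>k. wt k * (wsum A n k * y k))"
    by (intro tendsto_intros LIMSEQ_Suc[OF g] summable_LIMSEQ' s1 s2)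
  also have "(\<lambda>m. wsum A n (Suc m) * (\<Sum>k\<le>m. wt k * y k) - (\<Sum>k\<le>m. wt k * (wsum A n k * y k)))
      = (\<lambda>m. \<Sum>k\<le>m. dpart A n m k * y k)"
    by (rule ext) (simp add: dpart_eq_wsum sum_distrib_left algebra_simps flip: sum_subtractf)
  also have "g * (\<Sum>k. wt k * y k) - (\<Sum>k. wt k * (wsum A n k * y k)) = (\<Sum>k. dlim A n k * y k)"
    using suminf_diff[OF summable_mult[OF s1, of g] s2] suminf_mult[OF s1, of g]
    by (simp add: dlim_eq_wsum[OF g] algebra_simps)
  finally show ?thesis .
qed

text \<open>
  The row sums of \<^const>\<open>dpart\<close> are its action on the constant sequence \<open>1\<close>.
\<close>

lemma C2_imp_C6:
  assumes "C2 A"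
  shows "C6 A"
  using tendsto_sum_dpart_mult[OF assms convergent_const[of 1]] by (auto simp: C6_def convergent_def)

lemma C2_imp_mult_Finv_sums:
  assumes "C2 A" and "convergent y"
  shows "(\<lambda>j. A n j * Finv y j) sums (\<Sum>k. dlim A n k * y k)"
  using tendsto_sum_dpart_mult[OF assms, of n]
  unfolding sums_def sum_mult_Finv[symmetric] by (rule LIMSEQ_imp_Suc)

text \<open>
  At the preimage of the \<open>k\<close>-th unit sequence under \<^const>\<open>Fhat\<close>, the series for the \<open>n\<close>-th entry of
  the image has the partial sums \<open>dpart A n m k\<close>.
\<close>

lemma matrix_class_conv_Fhat_imp_C2:
  assumes "A \<in> matrix_class conv_Fhat Y"
  shows "C2 A"
  unfolding C2_def
proof (intro allI)
  fix n k
  have "summable (\<lambda>j. A n j * Finv (\<lambda>i. of_bool (i = k)) j)"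
    using assms convergent_unit_seq[of k] by (auto simp: matrix_class_def conv_Fhat_eq conv_seqs_def)
  then obtain s where "(\<lambda>m. \<Sum>j<m. A n j * Finv (\<lambda>i. of_bool (i = k)) j) \<longlonglongrightarrow> s"
    by (auto simp: summable_def sums_def)
  then have "(\<lambda>m. \<Sum>j<Suc m. A n j * Finv (\<lambda>i. of_bool (i = k)) j) \<longlonglongrightarrow> s"
    by (rule LIMSEQ_Suc)
  moreover have "(\<Sum>i\<le>m. dpart A n m i * of_bool (i = k)) = dpart A n m k" for m
    by (simp add: dpart_def)
  ultimately show "convergent (\<lambda>m. dpart A n m k)"
    by (auto simp: convergent_def sum_mult_Finv simp del: sum.lessThan_Suc)
qed

text \<open>
  Under \<^const>\<open>C2\<close> the two matrices have the same image sequences, \<open>A\<close> at \<open>Finv y\<close> and \<open>dlim A\<close> at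
  \<open>y\<close>, so membership transfers for any target space at once.
\<close>

lemma matrix_class_conv_Fhat_iff:
  "A \<in> matrix_class conv_Fhat Y \<longleftrightarrow> C2 A \<and> dlim A \<in> matrix_class conv_seqs Y"
proof (cases "C2 A")
  case True
  note sums = C2_imp_mult_Finv_sums[OF True]
  have "A \<in> matrix_class conv_Fhat Y \<longleftrightarrow> (\<forall>y. convergent y \<longrightarrow> (\<lambda>n. \<Sum>k. dlim A n k * y k) \<in> Y)"
    using sums_summable[OF sums] sums_unique[OF sums]
    by (auto simp: matrix_class_def conv_Fhat_eq conv_seqs_def)
  then show ?thesis
    using True mem_matrix_class_conv_seqs_iff[where D = "dlim A", OF C2_imp_summable_dlim[OF True]]
    by simp
next
  case False
  then show ?thesis
    using matrix_class_conv_Fhat_imp_C2 by blast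
qed


section \<open>Partial sums and differences of rows\<close>

lemma sum_matrix_diff_matrix: "sum_matrix (diff_matrix A) = A"
proof (intro ext)
  show "sum_matrix (diff_matrix A) n k = A n k" for n k
    by (induction n) (auto simp: sum_matrix_def diff_matrix_def)
qed

lemma diff_matrix_sum_matrix: "diff_matrix (sum_matrix A) = A"
proof (intro ext)
  show "diff_matrix (sum_matrix A) n k = A n k" for n k
    by (cases n) (auto simp: sum_matrix_def diff_matrix_def)
qed

lemma sum_matrix_mult_sums:
  assumes "\<And>n. summable (\<lambda>k. A n k * x k)"
  shows "(\<lambda>k. sum_matrix A n k * x k) sums (\<Sum>j\<le>n. \<Sum>k. A j k * x k)"
  using sums_sum[of "{..n}" "\<lambda>j k. A j k * x k"] summable_sums[OF assms]
  by (simp add: sum_matrix_def sum_distrib_right)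

lemma diff_matrix_mult_sums:
  assumes "\<And>n. summable (\<lambda>k. A n k * x k)"
  shows "(\<lambda>k. diff_matrix A n k * x k) sums
    ((\<Sum>k. A n k * x k) - (if n = 0 then 0 else \<Sum>k. A (n - 1) k * x k))"
proof (cases "n = 0")
  case True
  then show ?thesis
    using summable_sums[OF assms[of 0]] by (simp add: diff_matrix_def)
next
  case False
  then show ?thesis
    using sums_diff[OF summable_sums[OF assms[of n]] summable_sums[OF assms[of "n - 1"]]]
    by (simp add: diff_matrix_def left_diff_distrib)
qed

text \<open>
  The equivalence needs all rows at once: a single row of \<open>A\<close> is recovered from the rows of its
  difference matrix up to that index.
\<close>

lemma summable_diff_matrix_mult_iff:
  "(\<forall>n. summable (\<lambda>k. diff_matrix A n k * x k)) \<longleftrightarrow> (\<forall>n. summable (\<lambda>k. A n k * x k))"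
proof
  assume "\<forall>n. summable (\<lambda>k. diff_matrix A n k * x k)"
  then show "\<forall>n. summable (\<lambda>k. A n k * x k)"
    using sums_summable[OF sum_matrix_mult_sums[of "diff_matrix A" x]]
    by (simp only: sum_matrix_diff_matrix) blast
next
  assume "\<forall>n. summable (\<lambda>k. A n k * x k)"
  then show "\<forall>n. summable (\<lambda>k. diff_matrix A n k * x k)"
    using sums_summable[OF diff_matrix_mult_sums[of A x]] by blast
qed

lemma summable_sum_matrix_mult_iff:
  "(\<forall>n. summable (\<lambda>k. sum_matrix A n k * x k)) \<longleftrightarrow> (\<forall>n. summable (\<lambda>k. A n k * x k))"
  using summable_diff_matrix_mult_iff[of "sum_matrix A" x] by (simp add: diff_matrix_sum_matrix)

lemma sum_matrix_mem_matrix_class_iff: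
  "sum_matrix A \<in> matrix_class X Y \<longleftrightarrow> A \<in> matrix_class X {u. (\<lambda>n. \<Sum>j\<le>n. u j) \<in> Y}"
proof -
  have "((\<lambda>n. \<Sum>k. sum_matrix A n k * x k) \<in> Y) \<longleftrightarrow> (\<lambda>n. \<Sum>j\<le>n. \<Sum>k. A j k * x k) \<in> Y"
    if "\<forall>n. summable (\<lambda>k. A n k * x k)" for x
    using that by (simp add: sums_unique[OF sum_matrix_mult_sums, symmetric])
  then show ?thesis
    unfolding matrix_class_def mem_Collect_eq
    by (intro ball_cong refl conj_cong summable_sum_matrix_mult_iff)
qed

lemma diff_matrix_mem_matrix_class_iff:
  "diff_matrix A \<in> matrix_class X Y \<longleftrightarrow>
    A \<in> matrix_class X {u. (\<lambda>n. u n - (if n = 0 then 0 else u (n - 1))) \<in> Y}"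
proof -
  have "((\<lambda>n. \<Sum>k. diff_matrix A n k * x k) \<in> Y) \<longleftrightarrow>
      (\<lambda>n. (\<Sum>k. A n k * x k) - (if n = 0 then 0 else \<Sum>k. A (n - 1) k * x k)) \<in> Y"
    if "\<forall>n. summable (\<lambda>k. A n k * x k)" for x
    using that by (simp only: sums_unique[OF diff_matrix_mult_sums, symmetric])
  then show ?thesis
    unfolding matrix_class_def mem_Collect_eq
    by (intro ball_cong refl conj_cong summable_diff_matrix_mult_iff)
qed


section \<open>The eight matrix classes\<close>

lemma matrix_class_conv_Fhat_bounded:
  "A \<in> matrix_class conv_Fhat bounded_seqs \<longleftrightarrow> C1 A \<and> C2 A \<and> C3 A \<and> C6 A"
proof (cases "C2 A")
  case True
  show ?thesis
    using True
    by (simp add: matrix_class_conv_Fhat_iff matrix_class_conv_bounded_iff C3_def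
        C2_imp_summable_dlim C2_imp_C1 C2_imp_C6)
qed (simp add: matrix_class_conv_Fhat_iff)

lemma matrix_class_conv_Fhat_conv:
  "A \<in> matrix_class conv_Fhat conv_seqs \<longleftrightarrow> C1 A \<and> C2 A \<and> C3 A \<and> C4 A \<and> C6 A \<and> C7 A"
proof (cases "C2 A")
  case True
  show ?thesis
    using True summable_rabs_cancel[OF C2_imp_summable_dlim[OF True]]
    by (simp add: matrix_class_conv_Fhat_iff matrix_class_conv_conv_iff C3_def C4_def C7_def
        C2_imp_summable_dlim C2_imp_C1 C2_imp_C6)
qed (simp add: matrix_class_conv_Fhat_iff)

lemma matrix_class_conv_Fhat_null:
  "A \<in> matrix_class conv_Fhat null_seqs \<longleftrightarrow>
    C1 A \<and> C2 A \<and> C3 A \<and> (C4 A \<and> (\<forall>k. alpha_col A k = 0)) \<and> C6 A \<and> (C7 A \<and> alpha_sum A = 0)"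
proof (cases "C2 A")
  case True
  have zero: "(u \<longlonglongrightarrow> 0) \<longleftrightarrow> convergent u \<and> lim u = 0" for u :: real_seq
    by (metis convergent_LIMSEQ_iff convergentI limI)
  show ?thesis
    using True summable_rabs_cancel[OF C2_imp_summable_dlim[OF True]]
    by (simp add: matrix_class_conv_Fhat_iff matrix_class_conv_null_iff C3_def C4_def C7_def
        alpha_col_def alpha_sum_def zero all_conj_distrib C2_imp_summable_dlim C2_imp_C1 C2_imp_C6)
qed (simp add: matrix_class_conv_Fhat_iff)

lemma matrix_class_conv_Fhat_l1:
  "A \<in> matrix_class conv_Fhat l1_seqs \<longleftrightarrow> C1 A \<and> C2 A \<and> C5 A \<and> C6 A"
proof (cases "C2 A")
  case True
  show ?thesis
    using True
    by (simp add: matrix_class_conv_Fhat_iff matrix_class_conv_l1_iff C5_def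
        C2_imp_summable_dlim C2_imp_C1 C2_imp_C6)
qed (simp add: matrix_class_conv_Fhat_iff)

lemma bs_cs_bv_as_preimages:
  "bs_seqs = {u. (\<lambda>n. \<Sum>j\<le>n. u j) \<in> bounded_seqs}"
  "cs_seqs = {u. (\<lambda>n. \<Sum>j\<le>n. u j) \<in> conv_seqs}"
  "cs0_seqs = {u. (\<lambda>n. \<Sum>j\<le>n. u j) \<in> null_seqs}"
  "bv1_seqs = {u. (\<lambda>n. u n - (if n = 0 then 0 else u (n - 1))) \<in> l1_seqs}"
  by (simp_all add: bs_seqs_def cs_seqs_def cs0_seqs_def bv1_seqs_def bounded_seqs_def conv_seqs_def
      null_seqs_def l1_seqs_def)

theorem corollary4p9:
  fixes A :: inf_matrix
  shows "(A \<in> matrix_class conv_Fhat bounded_seqs \<longleftrightarrow> C1 A \<and> C2 A \<and> C3 A \<and> C6 A) \<and>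
    (A \<in> matrix_class conv_Fhat bs_seqs \<longleftrightarrow>
       C1 (sum_matrix A) \<and> C2 (sum_matrix A) \<and> C3 (sum_matrix A) \<and> C6 (sum_matrix A)) \<and>
    (A \<in> matrix_class conv_Fhat conv_seqs \<longleftrightarrow>
       C1 A \<and> C2 A \<and> C3 A \<and> C4 A \<and> C6 A \<and> C7 A) \<and>
    (A \<in> matrix_class conv_Fhat cs_seqs \<longleftrightarrow>
       C1 (sum_matrix A) \<and> C2 (sum_matrix A) \<and> C3 (sum_matrix A) \<and> C4 (sum_matrix A) \<and>
       C6 (sum_matrix A) \<and> C7 (sum_matrix A)) \<and>
    (A \<in> matrix_class conv_Fhat null_seqs \<longleftrightarrow>
       C1 A \<and> C2 A \<and> C3 A \<and> (C4 A \<and> (\<forall>k. alpha_col A k = 0)) \<and> C6 A \<and>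
       (C7 A \<and> alpha_sum A = 0)) \<and>
    (A \<in> matrix_class conv_Fhat cs0_seqs \<longleftrightarrow>
       C1 (sum_matrix A) \<and> C2 (sum_matrix A) \<and> C3 (sum_matrix A) \<and>
       (C4 (sum_matrix A) \<and> (\<forall>k. alpha_col (sum_matrix A) k = 0)) \<and> C6 (sum_matrix A) \<and>
       (C7 (sum_matrix A) \<and> alpha_sum (sum_matrix A) = 0)) \<and>
    (A \<in> matrix_class conv_Fhat l1_seqs \<longleftrightarrow> C1 A \<and> C2 A \<and> C5 A \<and> C6 A) \<and>
    (A \<in> matrix_class conv_Fhat bv1_seqs \<longleftrightarrow>
       C1 (diff_matrix A) \<and> C2 (diff_matrix A) \<and> C5 (diff_matrix A) \<and> C6 (diff_matrix A))"
  unfolding bs_cs_bv_as_preimages sum_matrix_mem_matrix_class_iff[symmetric]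
    diff_matrix_mem_matrix_class_iff[symmetric]
  by (intro conjI matrix_class_conv_Fhat_bounded matrix_class_conv_Fhat_conv
      matrix_class_conv_Fhat_null matrix_class_conv_Fhat_l1)

end
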